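(* Let $(X,d)$ be a complete metric space and $\mathfrak{m}$ a non-negative and non-zero Borel measure on $X$. Let $C\subset X$ be a closed subset on which $\mathfrak{m}$ is concentrated (i.e. $\mathfrak{m}(X\setminus C)=0$), and equip $C$ with the restrictions of the distance $d$ and of the measure $\mathfrak{m}$. Then for every $p\in[1,\infty)$ the functionals $\mathrm{Ch}_{p,X}$ and $\mathrm{Ch}_{p,C}$ coincide on $L^p(X,\mathfrak{m})\sim L^p(C,\mathfrak{m})$, i.e. $\mathrm{Ch}_{p,X}(f)=\mathrm{Ch}_{p,C}(f|_C)$ for every $f\in L^p(X,\mathfrak{m})$, where $L^p(X,\mathfrak{m})$ and $L^p(C,\mathfrak{m})$ are identified via restriction to $C$.
   Context: For a metric space $(Y,d)$, a function $h:Y\to\mathbb{R}$ and $A\subset Y$, put $$\mathrm{Lip}(h,A):=\sup\Big\{\frac{|h(y_1)-h(y_2)|}{d(y_1,y_2)} : y_1,y_2\in A,\ y_1\neq y_2\Big\},$$ with the convention that the supremum is $0$ if $A$ has at most one point. The asymptotic Lipschitz constant of $h$ at $x\in Y$ is $$\mathrm{lip}_a(h,x):=\inf_{r>0}\mathrm{Lip}(h,B_r(x))=\lim_{r\to0}\mathrm{Lip}(h,B_r(x)),$$ where $B_r(x)$ is the ball in $Y$ of radius $r$ centred at $x$; thus it depends on the domain $Y$ of $h$. Denote by $\mathrm{Lip}_{bs}(Y)$ the space of real-valued Lipschitz functions on $Y$ with bounded support. For a complete metric space $(Y,d)$ endowed with a non-negative, non-zero Borel measure $\mathfrak{m}$ and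 $p\in[1,\infty)$, the functional $\mathrm{Ch}_{p,Y}:L^p(Y,\mathfrak{m})\to[0,\infty]$ is defined by $$\mathrm{Ch}_{p,Y}(f):=\inf\Big\{\liminf_{n\to\infty}\int_Y \mathrm{lip}_a(f_n,x)^p\,d\mathfrak{m}(x) : f_n\in\mathrm{Lip}_{bs}(Y),\ f_n\to f\text{ in }L^p(Y,\mathfrak{m})\Big\},$$ where the asymptotic Lipschitz constants are computed relative to the domain $Y$ (and the infimum of the empty set is $+\infty$). In the claim this definition is applied with $Y=X$ and with $Y=C$. *)

theory Defs
  imports "HOL-Analysis.Analysis"
begin

text \<open>
  A metric measure space is encoded by a measure \<open>M\<close> over a metric type: the underlying metric
  space \<open>Y\<close> is \<^term>\<open>space M\<close> with the distance of the ambient type. A function on \<open>Y\<close> is a function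
  on the whole type of which only the values on \<open>Y\<close> matter.
\<close>

text \<open>The supremum is taken in \<^typ>\<open>ennreal\<close>, where \<^prop>\<open>Sup {} = (0::ennreal)\<close>.\<close>

definition Lip :: "('a::metric_space \<Rightarrow> real) \<Rightarrow> 'a set \<Rightarrow> ennreal" where
  "Lip h A = Sup {ennreal (\<bar>h y1 - h y2\<bar> / dist y1 y2) | y1 y2. y1 \<in> A \<and> y2 \<in> A \<and> y1 \<noteq> y2}"

definition lip_a :: "'a::metric_space set \<Rightarrow> ('a \<Rightarrow> real) \<Rightarrow> 'a \<Rightarrow> ennreal" where
  "lip_a Y h x = (INF r\<in>{0<..}. Lip h (ball x r \<inter> Y))"

definition Lip_bs :: "'a::metric_space set \<Rightarrow> ('a \<Rightarrow> real) set" where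
  "Lip_bs Y = {h. (\<exists>L. L-lipschitz_on Y h) \<and> bounded (closure {x \<in> Y. h x \<noteq> 0} \<inter> Y)}"

text \<open>Elements of \<open>L\<^sup>p\<close> are given by representatives.\<close>

definition Lp :: "real \<Rightarrow> 'a measure \<Rightarrow> ('a \<Rightarrow> real) set" where
  "Lp p M = {f \<in> borel_measurable M. integrable M (\<lambda>x. \<bar>f x\<bar> powr p)}"

definition Lp_norm :: "real \<Rightarrow> 'a measure \<Rightarrow> ('a \<Rightarrow> real) \<Rightarrow> real" where
  "Lp_norm p M f = (\<integral>x. \<bar>f x\<bar> powr p \<partial>M) powr (1 / p)"

definition Lp_tendsto ::
    "real \<Rightarrow> 'a measure \<Rightarrow> (nat \<Rightarrow> 'a \<Rightarrow> real) \<Rightarrow> ('a \<Rightarrow> real) \<Rightarrow> bool" where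
  "Lp_tendsto p M F f \<longleftrightarrow> f \<in> Lp p M \<and> (\<forall>n. F n \<in> Lp p M) \<and>
     (\<lambda>n. Lp_norm p M (\<lambda>x. F n x - f x)) \<longlonglongrightarrow> 0"

definition ennreal_powr :: "ennreal \<Rightarrow> real \<Rightarrow> ennreal" where
  "ennreal_powr a p = (if a = \<infinity> then \<infinity> else ennreal (enn2real a powr p))"

definition Ch :: "real \<Rightarrow> 'a::metric_space measure \<Rightarrow> ('a \<Rightarrow> real) \<Rightarrow> ennreal" where
  "Ch p M f = Inf {liminf (\<lambda>n. \<integral>\<^sup>+x. ennreal_powr (lip_a (space M) (F n) x) p \<partial>M) | F.
     (\<forall>n. F n \<in> Lip_bs (space M)) \<and> Lp_tendsto p M F f}"

end

theory Submission
  imports Defs "HOL-Real_Asymp.Real_Asymp"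
begin

text \<open>
  Restricting an approximating sequence from the whole space to \<open>C\<close> can only decrease asymptotic
  Lipschitz constants, and since \<open>C\<close> carries all the mass this gives one of the two inequalities.
  The other one follows once every Lipschitz function \<open>g\<close> on \<open>C\<close> with bounded support has an
  extension of the same kind to the whole space whose asymptotic Lipschitz constant at each point of
  \<open>C\<close> does not exceed that of \<open>g\<close> (\<open>Lip_bs_extension\<close>): replacing each approximating function
  by such an extension changes neither the \<open>L\<^sup>p\<close> convergence nor, except on a null set, the
  bound on the integrands. The extension has to preserve the constants exactly: an additive error
  \<open>\<epsilon>\<close> could not be integrated, as bounded sets may have infinite measure.

  Let \<open>g\<close> be \<open>L\<close>-Lipschitz on \<open>C\<close>. The McShane formula with the single constant \<open>L\<close> destroys
  the local constants, so one works scale by scale. At scale \<open>s\<close> (\<open>scale_ext\<close>) take the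
  infimum, over centres \<open>z\<close> in \<open>C\<close>, of the McShane extensions built from the values of \<open>g\<close> on the
  \<open>s\<close>-ball around \<open>z\<close> with the best constant there, each penalised by the slope \<open>L s\<close> away
  from \<open>z\<close>. At distance \<open>\<delta>\<close> from \<open>C\<close> no centre can undercut a nearby one by more than
  \<open>O(L \<delta>)\<close>, so for \<open>\<delta>\<close> much smaller than \<open>s\<^sup>2\<close> the penalty lets only centres closer than
  \<open>s\<close> win. Hence in a thin tube around \<open>C\<close> the result has the local constant of \<open>g\<close> up to the error \<open>L s\<close>
  (\<open>scale_ext_tube\<close>).

  The scales \<open>s = 2 ^ (- n)\<close> are then glued (\<open>glued_ext\<close>): at distance \<open>t\<close> from \<open>C\<close> one
  interpolates linearly in \<open>n\<close> at the real index \<open>k = sqrt (- ln t)\<close>. The extensions at different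
  scales all equal \<open>g\<close> on \<open>C\<close>, hence differ by \<open>O(L t)\<close>, whereas
  \<open>dk/dt = - 1 / (2 k t)\<close>, so moving through the scales contributes only a slope \<open>O(L / k)\<close>,
  which vanishes at \<open>C\<close>. Moreover \<open>t = exp (- k\<^sup>2)\<close> is eventually far below the tube width at
  scale \<open>2 ^ (- k)\<close>, so that the active scales always satisfy their local estimate, and their
  errors also vanish at \<open>C\<close>. Finally a cutoff makes the support bounded.
\<close>

section \<open>Extension at a single scale\<close>

definition least_lip :: "('a::metric_space \<Rightarrow> real) \<Rightarrow> 'a set \<Rightarrow> real" where
  "least_lip g A = Inf {K. K-lipschitz_on A g}"

lemma least_lip_le:
  assumes "K-lipschitz_on A g"
  shows "least_lip g A \<le> K"
  unfolding least_lip_def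
  by (rule cInf_lower) (use assms in \<open>auto intro!: bdd_belowI[of _ 0] dest: lipschitz_on_nonneg\<close>)

lemma lipschitz_on_least_lip:
  assumes "L-lipschitz_on A g"
  shows "(least_lip g A)-lipschitz_on A g"
proof (rule lipschitz_onI)
  show "0 \<le> least_lip g A"
    unfolding least_lip_def
    by (rule cInf_greatest) (use assms in \<open>auto dest: lipschitz_on_nonneg\<close>)
  fix x y assume xy: "x \<in> A" "y \<in> A"
  show "dist (g x) (g y) \<le> least_lip g A * dist x y"
  proof (cases "x = y")
    case False
    have "dist (g x) (g y) / dist x y \<le> least_lip g A"
      unfolding least_lip_def
    proof (rule cInf_greatest)
      show "{K. K-lipschitz_on A g} \<noteq> {}" using assms by auto
      fix K assume "K \<in> {K. K-lipschitz_on A g}"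
      then have "dist (g x) (g y) \<le> K * dist x y" using lipschitz_onD xy by blast
      then show "dist (g x) (g y) / dist x y \<le> K" using False by (simp add: divide_simps)
    qed
    then show ?thesis using False by (simp add: divide_simps split: if_splits)
  qed simp
qed

lemma infdist_less_iff:
  assumes "A \<noteq> {}"
  shows "infdist x A < e \<longleftrightarrow> (\<exists>a\<in>A. dist x a < e)"
  using assms by (simp add: infdist_def cINF_less_iff)

text \<open>
  The first two summands belong to the McShane extension of \<open>g\<close> from the \<open>s\<close>-ball around
  \<open>z\<close>, and the third is the small slope that makes nearby centres preferable. The last summand
  switches the centre \<open>z\<close> off outside its \<open>s\<close>-ball, where the local constant gives no control on
  \<open>g\<close>; it vanishes within distance \<open>s / 2\<close>, where it would spoil the local slope.
\<close>

definition local_cone ::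
    "real \<Rightarrow> real \<Rightarrow> ('a::metric_space \<Rightarrow> real) \<Rightarrow> 'a set \<Rightarrow> 'a \<times> 'a \<Rightarrow> 'a \<Rightarrow> real" where
  "local_cone L s g C i x = (case i of (z, y) \<Rightarrow>
     g y + least_lip g (C \<inter> ball z s) * dist x y + L * s * dist x z
       + 4 * L * max 0 (dist x z - s / 2))"

definition cones :: "'a::metric_space set \<Rightarrow> real \<Rightarrow> ('a \<times> 'a) set" where
  "cones C s = (SIGMA z:C. C \<inter> ball z s)"

definition scale_ext ::
    "real \<Rightarrow> real \<Rightarrow> ('a::metric_space \<Rightarrow> real) \<Rightarrow> 'a set \<Rightarrow> 'a \<Rightarrow> real" where
  "scale_ext L s g C x = (INF i\<in>cones C s. local_cone L s g C i x)"

context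
  fixes g :: "'a::metric_space \<Rightarrow> real" and C :: "'a set" and L s :: real
  assumes lip: "L-lipschitz_on C g" and L: "0 < L" and s: "0 < s" "s \<le> 1"
begin

lemma least_lip_ball:
  "(least_lip g (C \<inter> ball z s))-lipschitz_on (C \<inter> ball z s) g"
  "0 \<le> least_lip g (C \<inter> ball z s)" "least_lip g (C \<inter> ball z s) \<le> L"
proof -
  have *: "L-lipschitz_on (C \<inter> ball z s) g" using lip by (rule lipschitz_on_subset) auto
  show "(least_lip g (C \<inter> ball z s))-lipschitz_on (C \<inter> ball z s) g"
    using lipschitz_on_least_lip[OF *] .
  then show "0 \<le> least_lip g (C \<inter> ball z s)" by (rule lipschitz_on_nonneg)
  show "least_lip g (C \<inter> ball z s) \<le> L" using least_lip_le[OF *] .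
qed

lemma local_cone_le_dist: "local_cone L s g C i a \<le> local_cone L s g C i b + 6 * L * dist a b"
proof -
  obtain z y where i: "i = (z, y)" by (cases i)
  let ?l = "least_lip g (C \<inter> ball z s)"
  have 1: "?l * dist a y \<le> ?l * dist b y + L * dist a b"
  proof -
    have "?l * dist a y \<le> ?l * (dist a b + dist b y)"
      by (intro mult_left_mono dist_triangle least_lip_ball)
    also have "\<dots> \<le> ?l * dist b y + L * dist a b"
      using mult_right_mono[OF least_lip_ball(3)[of z] zero_le_dist[of a b]]
      by (simp add: algebra_simps)
    finally show ?thesis .
  qed
  have 2: "L * s * dist a z \<le> L * s * dist b z + L * dist a b"
  proof -
    have "L * s * dist a z \<le> L * s * (dist a b + dist b z)"
      using L s by (intro mult_left_mono dist_triangle) auto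
    moreover have "L * s * dist a b \<le> L * 1 * dist a b"
      using L s by (intro mult_right_mono mult_left_mono) auto
    ultimately show ?thesis by (simp add: algebra_simps)
  qed
  have "max 0 (dist a z - s / 2) \<le> max 0 (dist b z - s / 2) + dist a b"
    using dist_triangle[of a z b] zero_le_dist[of a b] by linarith
  then have 3: "4 * L * max 0 (dist a z - s / 2) \<le> 4 * L * (max 0 (dist b z - s / 2) + dist a b)"
    using L by (intro mult_left_mono) auto
  show ?thesis using 1 2 3 unfolding i local_cone_def by (simp add: algebra_simps)
qed

text \<open>
  If \<open>x\<close> is within \<open>s\<close> of the centre, the local Lipschitz bound applies. Otherwise
  \<open>dist x y \<le> dist x z + s \<le> 4 (dist x z - s / 2)\<close>, so the steep summand dominates the
  global Lipschitz bound.
\<close>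

lemma local_cone_ge:
  assumes "i \<in> cones C s" and x: "x \<in> C"
  shows "g x + L * s * dist x (fst i) \<le> local_cone L s g C i x"
proof -
  obtain z y where i: "i = (z, y)" by (cases i)
  have z: "z \<in> C" and y: "y \<in> C" "dist z y < s" using assms unfolding i cones_def by auto
  let ?l = "least_lip g (C \<inter> ball z s)"
  have "g x \<le> g y + ?l * dist x y + 4 * L * max 0 (dist x z - s / 2)"
  proof (cases "dist x z < s")
    case True
    have "dist (g x) (g y) \<le> ?l * dist x y"
      by (rule lipschitz_onD[OF least_lip_ball(1)]) (use x y True in \<open>auto simp: dist_commute\<close>)
    moreover have "0 \<le> 4 * L * max 0 (dist x z - s / 2)" using L by simp
    ultimately show ?thesis unfolding dist_real_def by linarith
  next
    case False
    have "dist (g x) (g y) \<le> L * dist x y" using lipschitz_onD[OF lip] x y by blast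
    also have "\<dots> \<le> L * (4 * (dist x z - s / 2))"
      using False y dist_triangle[of x y z] L by (intro mult_left_mono) auto
    also have "\<dots> = 4 * L * max 0 (dist x z - s / 2)" using False s by simp
    finally show ?thesis
      using mult_nonneg_nonneg[OF least_lip_ball(2) zero_le_dist, of z x y]
      unfolding dist_real_def by linarith
  qed
  then show ?thesis unfolding i local_cone_def by simp
qed

lemma local_cone_ge_self:
  assumes "i \<in> cones C s" and x: "x \<in> C"
  shows "g x \<le> local_cone L s g C i x"
proof -
  have "0 \<le> L * s * dist x (fst i)" using L s by simp
  then show ?thesis using local_cone_ge[OF assms] by linarith
qed

lemma cones_nonempty: "w \<in> C \<Longrightarrow> cones C s \<noteq> {}"
  using s by (force simp: cones_def)

lemma bdd_below_local_cones: "bdd_below ((\<lambda>i. local_cone L s g C i x) ` cones C s)"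
proof (cases "C = {}")
  case True
  then show ?thesis by (simp add: cones_def)
next
  case False
  then obtain w where w: "w \<in> C" by auto
  show ?thesis
  proof (rule bdd_belowI2)
    fix i assume i: "i \<in> cones C s"
    show "g w - 6 * L * dist w x \<le> local_cone L s g C i x" using local_cone_le_dist[of i w x] local_cone_ge_self[OF i w] by simp
  qed
qed

lemma scale_ext_eq:
  assumes x: "x \<in> C"
  shows "scale_ext L s g C x = g x"
proof (rule antisym)
  have i: "(x, x) \<in> cones C s" using x s by (simp add: cones_def)
  have "scale_ext L s g C x \<le> local_cone L s g C (x, x) x"
    unfolding scale_ext_def by (rule cINF_lower[OF bdd_below_local_cones i])
  then show "scale_ext L s g C x \<le> g x" using s by (simp add: local_cone_def)
  show "g x \<le> scale_ext L s g C x"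
    unfolding scale_ext_def
  proof (rule cINF_greatest)
    show "cones C s \<noteq> {}" using i by auto
    fix i assume "i \<in> cones C s"
    from local_cone_ge_self[OF this x] show "g x \<le> local_cone L s g C i x" .
  qed
qed

lemma lipschitz_scale_ext:
  assumes "C \<noteq> {}"
  shows "(6 * L)-lipschitz_on UNIV (scale_ext L s g C)"
proof (rule lipschitz_onI)
  have *: "scale_ext L s g C a - 6 * L * dist a b \<le> scale_ext L s g C b" for a b
    unfolding scale_ext_def[of L s g C b]
  proof (rule cINF_greatest)
    show "cones C s \<noteq> {}" using assms cones_nonempty by auto
    fix i assume "i \<in> cones C s"
    then have "scale_ext L s g C a \<le> local_cone L s g C i a"
      unfolding scale_ext_def by (rule cINF_lower[OF bdd_below_local_cones])
    then show "scale_ext L s g C a - 6 * L * dist a b \<le> local_cone L s g C i b"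
      using local_cone_le_dist[of i a b] by simp
  qed
  show "dist (scale_ext L s g C a) (scale_ext L s g C b) \<le> 6 * L * dist a b" for a b
    using *[of a b] *[of b a] by (simp add: dist_real_def dist_commute abs_le_iff)
qed (use L in simp)

text \<open>
  Near \<open>w\<close> a centre at distance at least \<open>s / 4\<close> pays a penalty of at least \<open>L s\<^sup>2 / 4\<close>, while
  all Lipschitz errors within the ball of radius \<open>s\<^sup>2 / 100\<close> add up to at most
  \<open>12 L s\<^sup>2 / 100\<close>. So only nearby centres compete, and their cones have slope at most
  \<open>\<Lambda> + L s\<close> there.
\<close>

lemma scale_ext_near:
  assumes w: "w \<in> C" and \<Lambda>: "\<Lambda>-lipschitz_on (C \<inter> ball w (2 * s)) g"
  shows "(\<Lambda> + L * s)-lipschitz_on (ball w (s\<^sup>2 / 100)) (scale_ext L s g C)"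
proof (rule lipschitz_onI)
  have \<Lambda>0: "0 \<le> \<Lambda>" using lipschitz_on_nonneg[OF \<Lambda>] .
  show 0: "0 \<le> \<Lambda> + L * s" using \<Lambda>0 L s by simp
  have ne: "C \<noteq> {}" using w by auto
  have ss: "s\<^sup>2 \<le> s" using s by (simp add: power2_eq_square mult_left_le)
  have *: "scale_ext L s g C a - (\<Lambda> + L * s) * dist a b \<le> scale_ext L s g C b"
    if a: "a \<in> ball w (s\<^sup>2 / 100)" and b: "b \<in> ball w (s\<^sup>2 / 100)" for a b
    unfolding scale_ext_def[of L s g C b]
  proof (rule cINF_greatest)
    show "cones C s \<noteq> {}" using cones_nonempty[OF w] .
    fix i assume i: "i \<in> cones C s"
    obtain z y where zy: "i = (z, y)" by (cases i)
    show "scale_ext L s g C a - (\<Lambda> + L * s) * dist a b \<le> local_cone L s g C i b"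
    proof (cases "dist w z < s / 4")
      case True
      let ?l = "least_lip g (C \<inter> ball z s)"
      have l: "?l \<le> \<Lambda>"
      proof (rule least_lip_le, rule lipschitz_on_subset[OF \<Lambda>])
        have "ball z s \<subseteq> ball w (2 * s)"
        proof
          fix v assume "v \<in> ball z s"
          then show "v \<in> ball w (2 * s)" using True dist_triangle[of w v z] s by simp
        qed
        then show "C \<inter> ball z s \<subseteq> C \<inter> ball w (2 * s)" by auto
      qed
      have "dist a z < s / 2" "dist b z < s / 2"
        using a b True ss s dist_triangle[of a z w] dist_triangle[of b z w]
        by (auto simp: dist_commute)
      then have max0: "max 0 (dist a z - s / 2) = 0" "max 0 (dist b z - s / 2) = 0" by auto
      have "?l * dist a y \<le> ?l * (dist a b + dist b y)"
        by (intro mult_left_mono dist_triangle least_lip_ball)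
      moreover have "?l * dist a b \<le> \<Lambda> * dist a b" using l by (intro mult_right_mono) auto
      moreover have "L * s * dist a z \<le> L * s * (dist a b + dist b z)"
        using L s by (intro mult_left_mono dist_triangle) auto
      ultimately have "local_cone L s g C i a \<le> local_cone L s g C i b + (\<Lambda> + L * s) * dist a b"
        unfolding zy local_cone_def prod.case max0 by (simp add: algebra_simps)
      moreover have "scale_ext L s g C a \<le> local_cone L s g C i a"
        unfolding scale_ext_def using i by (rule cINF_lower[OF bdd_below_local_cones])
      ultimately show ?thesis by simp
    next
      case False
      have "g w + L * s * (s / 4) \<le> g w + L * s * dist w (fst i)"
        using False L s by (intro add_left_mono mult_left_mono) (auto simp: zy)
      also have "\<dots> \<le> local_cone L s g C i w" by (rule local_cone_ge[OF i w])
      also have "\<dots> \<le> local_cone L s g C i b + 6 * L * dist w b" by (rule local_cone_le_dist)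
      finally have 1: "g w + L * s\<^sup>2 / 4 \<le> local_cone L s g C i b + 6 * L * dist w b"
        by (simp add: power2_eq_square)
      have "dist (scale_ext L s g C a) (scale_ext L s g C w) \<le> 6 * L * dist a w"
        by (rule lipschitz_onD[OF lipschitz_scale_ext[OF ne]]) auto
      then have 2: "scale_ext L s g C a \<le> g w + 6 * L * dist w a"
        using scale_ext_eq[OF w] by (simp add: dist_real_def dist_commute)
      have 3: "6 * L * dist w a \<le> 6 * L * (s\<^sup>2 / 100)" "6 * L * dist w b \<le> 6 * L * (s\<^sup>2 / 100)"
        using a b L by (auto intro!: mult_left_mono)
      have 4: "0 \<le> (\<Lambda> + L * s) * dist a b" using 0 by simp
      have 5: "0 \<le> L * s\<^sup>2" using L by simp
      show ?thesis using 1 2 3 4 5 by simp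
    qed
  qed
  show "dist (scale_ext L s g C a) (scale_ext L s g C b) \<le> (\<Lambda> + L * s) * dist a b"
    if "a \<in> ball w (s\<^sup>2 / 100)" "b \<in> ball w (s\<^sup>2 / 100)" for a b
    using *[of a b] *[of b a] that by (simp add: dist_real_def dist_commute abs_le_iff)
qed

text \<open>
  Gluing requires the estimate on balls whose radius does not shrink with the scale. Two points of
  the tube at distance at least \<open>s\<^sup>2 / 200\<close> are compared through nearby points of \<open>C\<close>; the
  resulting error is a multiple of the tube width, which is small against \<open>s\<close> times that distance.
\<close>

lemma scale_ext_tube:
  assumes w: "w \<in> C" and \<Lambda>: "\<Lambda>-lipschitz_on (C \<inter> ball w \<rho>) g" and \<rho>: "6 * s \<le> \<rho>"
  shows "(\<Lambda> + L * s)-lipschitz_on (ball w (\<rho> / 2) \<inter> {x. infdist x C < s ^ 3 / 3000})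
           (scale_ext L s g C)"
proof (rule lipschitz_onI)
  have \<Lambda>0: "0 \<le> \<Lambda>" using lipschitz_on_nonneg[OF \<Lambda>] .
  show 0: "0 \<le> \<Lambda> + L * s" using \<Lambda>0 L s by simp
  have ne: "C \<noteq> {}" using w by auto
  define \<delta> where "\<delta> = s ^ 3 / 3000"
  have \<delta>s: "\<delta> \<le> s\<^sup>2 / 3000" "s\<^sup>2 \<le> s"
    using s by (auto simp: \<delta>_def power3_eq_cube power2_eq_square mult_left_le mult_le_one)
  fix a b assume "a \<in> ball w (\<rho> / 2) \<inter> {x. infdist x C < s ^ 3 / 3000}"
    "b \<in> ball w (\<rho> / 2) \<inter> {x. infdist x C < s ^ 3 / 3000}"
  then have ab: "dist w a < \<rho> / 2" "infdist a C < \<delta>" "dist w b < \<rho> / 2" "infdist b C < \<delta>"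
    by (auto simp: \<delta>_def)
  obtain a' where a': "a' \<in> C" "dist a a' < \<delta>"
    using ab(2) ne by (auto simp: infdist_less_iff)
  obtain b' where b': "b' \<in> C" "dist b b' < \<delta>"
    using ab(4) ne by (auto simp: infdist_less_iff)
  have wa': "dist w a' < \<rho> / 2 + s" and wb': "dist w b' < \<rho> / 2 + s"
    using a' b' ab \<delta>s dist_triangle[of w a' a] dist_triangle[of w b' b] s by linarith+
  let ?h = "scale_ext L s g C"
  show "dist (?h a) (?h b) \<le> (\<Lambda> + L * s) * dist a b"
  proof (cases "dist a b < s\<^sup>2 / 200")
    case True
    have "ball a' (2 * s) \<subseteq> ball w \<rho>"
    proof
      fix v assume "v \<in> ball a' (2 * s)"
      then show "v \<in> ball w \<rho>" using wa' \<rho> dist_triangle[of w v a'] by simp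
    qed
    then have "(\<Lambda> + L * s)-lipschitz_on (ball a' (s\<^sup>2 / 100)) ?h"
      by (intro scale_ext_near a' lipschitz_on_subset[OF \<Lambda>]) auto
    moreover have "0 < s\<^sup>2" using s by simp
    then have "dist a' a < s\<^sup>2 / 100" "dist a' b < s\<^sup>2 / 100"
      using a' True \<delta>s dist_triangle[of a' b a] dist_commute[of a a'] by linarith+
    ultimately show ?thesis by (auto intro: lipschitz_onD)
  next
    case False
    have hL: "dist (?h u) (?h v) \<le> 6 * L * dist u v" for u v
      by (rule lipschitz_onD[OF lipschitz_scale_ext[OF ne]]) auto
    \<comment> \<open>\<open>\<Lambda>\<close> may be far larger than \<open>L\<close>; the error terms below must be bounded by \<open>L\<close>.\<close>
    have m: "(min \<Lambda> L)-lipschitz_on (C \<inter> ball w \<rho>) g"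
      using \<Lambda> lipschitz_on_subset[OF lip, of "C \<inter> ball w \<rho>"] by (simp add: min_def)
    have in_ball: "a' \<in> ball w \<rho>" "b' \<in> ball w \<rho>" using wa' wb' \<rho> s by auto
    have "dist (g a') (g b') \<le> min \<Lambda> L * dist a' b'"
      by (rule lipschitz_onD[OF m]) (use a' b' in_ball in auto)
    also have "\<dots> \<le> min \<Lambda> L * (dist a b + 2 * \<delta>)"
      using a' b' dist_triangle[of a' b' a] dist_triangle[of a b' b] \<Lambda>0 L
      by (intro mult_left_mono) (auto simp: dist_commute)
    also have "\<dots> = min \<Lambda> L * dist a b + min \<Lambda> L * (2 * \<delta>)" by (simp add: algebra_simps)
    also have "\<dots> \<le> \<Lambda> * dist a b + L * (2 * \<delta>)"
      using s by (intro add_mono mult_right_mono) (auto simp: \<delta>_def)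
    finally have 1: "dist (g a') (g b') \<le> \<Lambda> * dist a b + 2 * L * \<delta>" by simp
    have 2: "dist (?h a) (g a') \<le> 6 * L * \<delta>" "dist (?h b) (g b') \<le> 6 * L * \<delta>"
      using a' b' L
      by (auto simp flip: scale_ext_eq intro!: order_trans[OF hL] mult_left_mono)
    have "14 * L * \<delta> \<le> L * s * (s\<^sup>2 / 200)"
      using L s by (simp add: \<delta>_def power3_eq_cube power2_eq_square)
    also have "\<dots> \<le> L * s * dist a b" using False L s by (intro mult_left_mono) auto
    finally show ?thesis using 1 2 by (simp add: dist_real_def algebra_simps)
  qed
qed

end

section \<open>Gluing the scales\<close>

definition interp :: "(nat \<Rightarrow> real) \<Rightarrow> real \<Rightarrow> real" where
  "interp c k = (1 - frac k) * c (nat \<lfloor>k\<rfloor>) + frac k * c (Suc (nat \<lfloor>k\<rfloor>))"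

lemma dist_interp_sequences:
  assumes "dist (c (nat \<lfloor>k\<rfloor>)) (c' (nat \<lfloor>k\<rfloor>)) \<le> D"
    and "dist (c (Suc (nat \<lfloor>k\<rfloor>))) (c' (Suc (nat \<lfloor>k\<rfloor>))) \<le> D"
  shows "dist (interp c k) (interp c' k) \<le> D"
proof -
  let ?n = "nat \<lfloor>k\<rfloor>"
  have f: "0 \<le> frac k" "0 \<le> 1 - frac k" by (auto simp: frac_lt_1 less_imp_le)
  have "interp c k - interp c' k
      = (1 - frac k) * (c ?n - c' ?n) + frac k * (c (Suc ?n) - c' (Suc ?n))"
    unfolding interp_def by (simp add: algebra_simps)
  also have "\<bar>\<dots>\<bar> \<le> (1 - frac k) * \<bar>c ?n - c' ?n\<bar> + frac k * \<bar>c (Suc ?n) - c' (Suc ?n)\<bar>"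
    using f by (intro order_trans[OF abs_triangle_ineq]) (simp add: abs_mult)
  also have "\<dots> \<le> (1 - frac k) * D + frac k * D"
    using assms f by (intro add_mono mult_left_mono) (auto simp: dist_real_def)
  finally show ?thesis by (simp add: dist_real_def algebra_simps)
qed

lemma interp_const: "interp (\<lambda>n. c) k = c"
  by (simp add: interp_def algebra_simps)

text \<open>
  Indices in the same or in adjacent unit intervals are compared at their common breakpoint; for
  indices at distance at least \<open>1\<close> it suffices that both values are convex combinations of terms
  pairwise within \<open>D\<close>.
\<close>

lemma lipschitz_interp:
  assumes D: "\<And>m n. dist (c m) (c n) \<le> D"
  shows "D-lipschitz_on {0..} (interp c)"
proof (rule lipschitz_onI)
  show D0: "0 \<le> D" using D[of 0 0] by simp
  have *: "dist (interp c k) (interp c l) \<le> D * (l - k)" if kl: "0 \<le> k" "k \<le> l" for k l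
  proof -
    have "nat \<lfloor>l\<rfloor> = nat \<lfloor>k\<rfloor> \<or> nat \<lfloor>l\<rfloor> = Suc (nat \<lfloor>k\<rfloor>) \<or> 1 \<le> l - k"
      using kl by linarith
    then show ?thesis
    proof (elim disjE)
      assume eq: "nat \<lfloor>l\<rfloor> = nat \<lfloor>k\<rfloor>"
      then have "\<lfloor>l\<rfloor> = \<lfloor>k\<rfloor>" using kl by (auto simp: nat_eq_iff split: if_splits)
      then have "interp c k - interp c l = (l - k) * (c (nat \<lfloor>k\<rfloor>) - c (Suc (nat \<lfloor>k\<rfloor>)))"
        unfolding interp_def frac_def eq by (simp add: algebra_simps)
      then show ?thesis
        using mult_left_mono[OF D[of "nat \<lfloor>k\<rfloor>" "Suc (nat \<lfloor>k\<rfloor>)"], of "l - k"] kl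
        by (simp add: dist_real_def abs_mult mult.commute)
    next
      assume eq: "nat \<lfloor>l\<rfloor> = Suc (nat \<lfloor>k\<rfloor>)"
      then have fl: "\<lfloor>l\<rfloor> = \<lfloor>k\<rfloor> + 1" using kl by linarith
      let ?n = "nat \<lfloor>k\<rfloor>"
      have "interp c k - interp c l
          = (1 - frac k) * (c ?n - c (Suc ?n)) + frac l * (c (Suc ?n) - c (Suc (Suc ?n)))"
        unfolding interp_def eq by (simp add: algebra_simps)
      also have "\<bar>\<dots>\<bar> \<le> (1 - frac k) * \<bar>c ?n - c (Suc ?n)\<bar> + frac l * \<bar>c (Suc ?n) - c (Suc (Suc ?n))\<bar>"
        by (intro order_trans[OF abs_triangle_ineq])
          (simp add: abs_mult frac_lt_1 less_imp_le)
      also have "\<dots> \<le> (1 - frac k) * D + frac l * D"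
        using D[of ?n "Suc ?n"] D[of "Suc ?n" "Suc (Suc ?n)"]
        by (intro add_mono mult_left_mono) (auto simp: dist_real_def frac_lt_1 less_imp_le)
      also have "\<dots> = D * (l - k)" using fl by (simp add: frac_def algebra_simps)
      finally show ?thesis by (simp add: dist_real_def)
    next
      assume 1: "1 \<le> l - k"
      have far: "dist (interp c k) (interp (\<lambda>_. interp c l) k) \<le> D"
      proof (rule dist_interp_sequences)
        have "dist (c n) (interp c l) \<le> D" for n
          using dist_interp_sequences[of "\<lambda>_. c n" l c D] D by (simp add: interp_const)
        then show "dist (c (nat \<lfloor>k\<rfloor>)) (interp c l) \<le> D"
          "dist (c (Suc (nat \<lfloor>k\<rfloor>))) (interp c l) \<le> D" by auto
      qed
      then have "dist (interp c k) (interp c l) \<le> D * 1" by (simp add: interp_const)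
      also have "\<dots> \<le> D * (l - k)" using 1 D0 by (intro mult_left_mono) auto
      finally show ?thesis .
    qed
  qed
  show "dist (interp c k) (interp c l) \<le> D * dist k l" if "k \<in> {0..}" "l \<in> {0..}" for k l
    using *[of k l] *[of l k] that by (cases "k \<le> l") (auto simp: dist_real_def abs_minus_commute)
qed

text \<open>
  The scale index in use at distance \<open>t\<close> from \<open>C\<close>. Taking the maximum keeps \<open>index\<close> Lipschitz in
  \<open>ln t\<close>. The value at \<open>t = 0\<close> (namely \<open>1\<close>, as \<open>ln 0 = 0\<close>) is immaterial, because on \<open>C\<close>
  all scales agree.
\<close>

definition index :: "real \<Rightarrow> real" where
  "index t = sqrt (max 1 (- ln t))"

lemma index_ge_1: "1 \<le> index t"
  by (simp add: index_def)

text \<open>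
  This is the two-point form of \<open>t \<bar>index' t\<bar> \<le> 1 / (2 index t)\<close>. The smaller distance stands
  on the left and the index of the larger one on the right, which is how the two-point estimate for
  the glued extension uses it; in particular it allows \<open>t = 0\<close>.
\<close>

lemma index_slow:
  assumes "0 \<le> t" "t \<le> u"
  shows "t * dist (index t) (index u) \<le> (u - t) / (2 * index u)"
proof (cases "t = 0")
  case True
  then show ?thesis using assms index_ge_1[of u] by simp
next
  case False
  then have t: "0 < t" "0 < u" using assms by auto
  define p q where "p = max 1 (- ln t)" and "q = max 1 (- ln u)"
  have "ln t \<le> ln u" using t assms by simp
  then have qp: "1 \<le> q" "q \<le> p" by (auto simp: p_def q_def)
  have "p - q \<le> ln u - ln t" using \<open>ln t \<le> ln u\<close> by (auto simp: p_def q_def)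
  also have "\<dots> = ln (u / t)" using t by (simp add: ln_div)
  also have "\<dots> \<le> u / t - 1" using t by (intro ln_le_minus_one) auto
  finally have pq: "t * (p - q) \<le> u - t" using t by (simp add: field_simps)
  have "(sqrt p - sqrt q) * (2 * sqrt q) \<le> (sqrt p - sqrt q) * (sqrt p + sqrt q)"
    using qp by (intro mult_left_mono) auto
  also have "\<dots> = p - q" using qp by (simp add: algebra_simps)
  finally have "t * ((sqrt p - sqrt q) * (2 * sqrt q)) \<le> t * (p - q)"
    using t by (intro mult_left_mono) auto
  then have "t * (sqrt p - sqrt q) * (2 * sqrt q) \<le> u - t" using pq by (simp add: mult.assoc)
  then have "t * (sqrt p - sqrt q) \<le> (u - t) / (2 * sqrt q)" using qp by (simp add: pos_le_divide_eq)
  moreover have "dist (index t) (index u) = sqrt p - sqrt q"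
    using qp by (simp add: index_def p_def q_def dist_real_def)
  ultimately show ?thesis by (simp add: index_def q_def)
qed

lemma index_near_0: "eventually (\<lambda>t. index t = sqrt (- ln t)) (at_right 0)"
proof -
  have "eventually (\<lambda>t::real. 1 \<le> - ln t) (at_right 0)" by real_asymp
  then show ?thesis by eventually_elim (simp add: index_def)
qed

lemma index_at_0: "filterlim index at_top (at_right 0)"
proof -
  have "filterlim (\<lambda>t::real. sqrt (- ln t)) at_top (at_right 0)" by real_asymp
  then show ?thesis using index_near_0 by (subst filterlim_cong[OF refl refl])
qed

text \<open>
  The distance \<open>t = exp (- k\<^sup>2)\<close> belonging to the index \<open>k\<close> decays faster than the tube width
  \<open>8 ^ (- n) / 3000\<close> of both scales \<open>n \<le> k + 1\<close> that are interpolated.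
\<close>

lemma index_below_scales:
  "eventually (\<lambda>t. \<forall>n. real n \<le> index t + 1 \<longrightarrow> t < ((1 / 2) ^ n) ^ 3 / 3000) (at_right 0)"
proof -
  have "eventually (\<lambda>t::real. t < (1 / 8) powr (sqrt (- ln t) + 1) / 3000) (at_right 0)"
    by real_asymp
  with index_near_0 show ?thesis
  proof eventually_elim
    fix t :: real
    assume t: "index t = sqrt (- ln t)" "t < (1 / 8) powr (sqrt (- ln t) + 1) / 3000"
    show "\<forall>n. real n \<le> index t + 1 \<longrightarrow> t < ((1 / 2) ^ n) ^ 3 / 3000"
    proof (intro allI impI)
      fix n assume "real n \<le> index t + 1"
      then have "(1 / 8) powr (sqrt (- ln t) + 1) \<le> (1 / 8) powr real n"
        using t by (intro powr_mono') auto
      also have "\<dots> = ((1 / 2) ^ n) ^ 3"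
        by (simp add: powr_realpow power_mult[symmetric] mult.commute[of n] power_mult power3_eq_cube
            flip: power_mult_distrib)
      finally show "t < ((1 / 2) ^ n) ^ 3 / 3000" using t by simp
    qed
  qed
qed

definition glued_ext ::
    "real \<Rightarrow> ('a::metric_space \<Rightarrow> real) \<Rightarrow> 'a set \<Rightarrow> 'a \<Rightarrow> real" where
  "glued_ext L g C x = interp (\<lambda>n. scale_ext L ((1 / 2) ^ n) g C x) (index (infdist x C))"

context
  fixes g :: "'a::metric_space \<Rightarrow> real" and C :: "'a set" and L :: real
  assumes lip: "L-lipschitz_on C g" and L: "0 < L"
begin

lemma glued_ext_eq:
  assumes "x \<in> C"
  shows "glued_ext L g C x = g x"
proof -
  have "scale_ext L ((1 / 2) ^ n) g C x = g x" for n
    by (rule scale_ext_eq[OF lip L _ _ assms]) (auto simp: power_le_one)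
  then show ?thesis by (simp add: glued_ext_def interp_const)
qed

lemma dist_scale_ext:
  assumes "C \<noteq> {}"
  shows "dist (scale_ext L ((1 / 2) ^ n) g C a) (scale_ext L ((1 / 2) ^ n) g C b) \<le> 6 * L * dist a b"
  by (rule lipschitz_onD[OF lipschitz_scale_ext[OF lip L _ _ assms]]) (auto simp: power_le_one)

text \<open>
  All scales equal \<open>g\<close> on \<open>C\<close> and are \<open>6 L\<close>-Lipschitz.
\<close>

lemma dist_scales:
  assumes ne: "C \<noteq> {}"
  shows "dist (scale_ext L ((1 / 2) ^ m) g C x) (scale_ext L ((1 / 2) ^ n) g C x)
           \<le> 12 * L * infdist x C" (is "dist (?h m) (?h n) \<le> _")
proof -
  have "dist (?h m) (?h n) / (12 * L) \<le> infdist x C"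
    unfolding infdist_notempty[OF ne]
  proof (rule cINF_greatest[OF ne])
    fix y assume y: "y \<in> C"
    have eq: "scale_ext L ((1 / 2) ^ k) g C y = g y" for k
      by (rule scale_ext_eq[OF lip L _ _ y]) (auto simp: power_le_one)
    have "dist (?h m) (?h n) \<le> 12 * L * dist x y"
      using dist_scale_ext[OF ne, of m x y] dist_scale_ext[OF ne, of n x y]
        dist_triangle2[of "?h m" "?h n" "g y"] by (simp add: eq)
    then show "dist (?h m) (?h n) / (12 * L) \<le> dist x y" using L by (simp add: field_simps)
  qed
  then show ?thesis using L by (simp add: field_simps)
qed

text \<open>
  First the index is changed at \<open>a\<close>, the point closer to \<open>C\<close>, where the scales differ least,
  then the point is changed at a fixed index.
\<close>

lemma glued_ext_two_point:
  assumes ne: "C \<noteq> {}" and ab: "infdist a C \<le> infdist b C"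
  shows "dist (glued_ext L g C a) (glued_ext L g C b) \<le> 6 * L / index (infdist b C) * dist a b
    + dist (interp (\<lambda>n. scale_ext L ((1 / 2) ^ n) g C a) (index (infdist b C)))
        (interp (\<lambda>n. scale_ext L ((1 / 2) ^ n) g C b) (index (infdist b C)))"
    (is "_ \<le> _ + dist (?P a (index ?u)) (?P b (index ?u))")
proof -
  let ?t = "infdist a C"
  have pos: "0 < index s" "0 \<le> index s" for s using index_ge_1[of s] by auto
  have "dist (?P a (index ?t)) (?P a (index ?u)) \<le> 12 * L * ?t * dist (index ?t) (index ?u)"
    by (rule lipschitz_onD[OF lipschitz_interp[OF dist_scales[OF ne]]]) (auto simp: pos)
  also have "\<dots> = 12 * L * (?t * dist (index ?t) (index ?u))" by simp
  also have "\<dots> \<le> 12 * L * ((?u - ?t) / (2 * index ?u))"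
    using L ab by (intro mult_left_mono index_slow) (auto simp: infdist_nonneg)
  also have "\<dots> = 6 * L / index ?u * (?u - ?t)" by simp
  also have "\<dots> \<le> 6 * L / index ?u * dist a b"
    using L infdist_triangle[of b C a] pos
    by (intro mult_left_mono) (auto simp: dist_commute intro!: divide_nonneg_nonneg)
  finally show ?thesis
    unfolding glued_ext_def using dist_triangle[of "?P a (index ?t)" "?P b (index ?u)" "?P a (index ?u)"]
    by linarith
qed

lemma lipschitz_glued_ext:
  assumes ne: "C \<noteq> {}"
  shows "(12 * L)-lipschitz_on UNIV (glued_ext L g C)"
proof (rule lipschitz_onI)
  have *: "dist (glued_ext L g C a) (glued_ext L g C b) \<le> 12 * L * dist a b"
    if "infdist a C \<le> infdist b C" for a b
  proof -
    have "6 * L / index (infdist b C) * dist a b \<le> 6 * L * dist a b"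
      using L index_ge_1[of "infdist b C"]
      by (intro mult_right_mono) (auto simp: divide_le_eq mult_le_cancel_left1)
    moreover have "dist (interp (\<lambda>n. scale_ext L ((1 / 2) ^ n) g C a) (index (infdist b C)))
        (interp (\<lambda>n. scale_ext L ((1 / 2) ^ n) g C b) (index (infdist b C))) \<le> 6 * L * dist a b"
      by (intro dist_interp_sequences dist_scale_ext ne)
    ultimately show ?thesis using glued_ext_two_point[OF ne that] by linarith
  qed
  show "dist (glued_ext L g C a) (glued_ext L g C b) \<le> 12 * L * dist a b" for a b
    using *[of a b] *[of b a] by (cases "infdist a C \<le> infdist b C") (auto simp: dist_commute)
qed (use L in simp)

text \<open>
  Close to \<open>w\<close> the distance to \<open>C\<close> is small, so the index is large: both the slope from changing
  the index and the error \<open>L 2 ^ (- n)\<close> of the active scales are then at most \<open>\<eta> / 2\<close>.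
\<close>

lemma glued_ext_local:
  assumes C: "closed C" and w: "w \<in> C" and \<Lambda>: "\<Lambda>-lipschitz_on (C \<inter> ball w \<rho>) g"
    and \<rho>: "0 < \<rho>" and \<eta>: "0 < \<eta>"
  shows "\<exists>\<sigma>>0. (\<Lambda> + \<eta>)-lipschitz_on (ball w \<sigma>) (glued_ext L g C)"
proof -
  have ne: "C \<noteq> {}" using w by auto
  have \<Lambda>0: "0 \<le> \<Lambda>" using lipschitz_on_nonneg[OF \<Lambda>] .
  obtain N where N: "(1 / 2) ^ N < min (\<eta> / (2 * L)) (\<rho> / 6)"
    using real_arch_pow_inv[of "min (\<eta> / (2 * L)) (\<rho> / 6)" "1 / 2"] \<eta> L \<rho> by auto
  have "eventually (\<lambda>t. max (real N + 1) (12 * L / \<eta>) \<le> index t) (at_right 0)"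
    using index_at_0 unfolding filterlim_at_top by blast
  then have "eventually (\<lambda>t. max (real N + 1) (12 * L / \<eta>) \<le> index t
      \<and> (\<forall>n. real n \<le> index t + 1 \<longrightarrow> t < ((1 / 2) ^ n) ^ 3 / 3000)) (at_right 0)"
    using index_below_scales by (rule eventually_conj)
  then obtain \<tau> where \<tau>: "0 < \<tau>" and
    \<tau>D: "\<And>t. 0 < t \<Longrightarrow> t < \<tau> \<Longrightarrow> max (real N + 1) (12 * L / \<eta>) \<le> index t
      \<and> (\<forall>n. real n \<le> index t + 1 \<longrightarrow> t < ((1 / 2) ^ n) ^ 3 / 3000)"
    unfolding eventually_at_right_field by blast
  define \<sigma> where "\<sigma> = min \<tau> (\<rho> / 2)"
  have *: "dist (glued_ext L g C a) (glued_ext L g C b) \<le> (\<Lambda> + \<eta>) * dist a b"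
    if a: "a \<in> ball w \<sigma>" and b: "b \<in> ball w \<sigma>" and ab: "infdist a C \<le> infdist b C" for a b
  proof (cases "infdist b C = 0")
    case True
    then have "infdist a C = 0" using ab infdist_nonneg[of a C] by simp
    then have in_C: "a \<in> C" "b \<in> C" using True C ne by (auto simp: in_closed_iff_infdist_zero)
    have "dist (g a) (g b) \<le> \<Lambda> * dist a b"
      by (rule lipschitz_onD[OF \<Lambda>]) (use a b in_C \<rho> in \<open>auto simp: \<sigma>_def\<close>)
    also have "\<dots> \<le> (\<Lambda> + \<eta>) * dist a b" using \<eta> by (intro mult_right_mono) auto
    finally show ?thesis using in_C by (simp add: glued_ext_eq)
  next
    case False
    define t where "t = infdist b C"
    have "t \<le> dist b w" using w by (simp add: t_def infdist_le)
    then have t: "0 < t" "t < \<tau>"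
      using False infdist_nonneg[of b C] b by (auto simp: t_def \<sigma>_def dist_commute)
    note tD = \<tau>D[OF t]
    have scale: "dist (scale_ext L ((1 / 2) ^ n) g C a) (scale_ext L ((1 / 2) ^ n) g C b)
        \<le> (\<Lambda> + \<eta> / 2) * dist a b" if n: "N \<le> n" "real n \<le> index t + 1" for n
    proof -
      have p: "(1 / 2 :: real) ^ n \<le> (1 / 2) ^ N" using n by (intro power_decreasing) auto
      have "(\<Lambda> + L * (1 / 2) ^ n)-lipschitz_on
          (ball w (\<rho> / 2) \<inter> {x. infdist x C < ((1 / 2) ^ n) ^ 3 / 3000})
          (scale_ext L ((1 / 2) ^ n) g C)"
      proof (rule scale_ext_tube[OF lip L _ _ w \<Lambda>])
        show "6 * (1 / 2) ^ n \<le> \<rho>" using p N unfolding min_less_iff_conj by linarith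
      qed (auto simp: power_le_one)
      moreover have "t < ((1 / 2) ^ n) ^ 3 / 3000" using tD n by blast
      ultimately have "dist (scale_ext L ((1 / 2) ^ n) g C a) (scale_ext L ((1 / 2) ^ n) g C b)
          \<le> (\<Lambda> + L * (1 / 2) ^ n) * dist a b"
        using a b ab by (intro lipschitz_onD) (auto simp: t_def \<sigma>_def)
      also have "(1 / 2) ^ n \<le> \<eta> / (2 * L)" using p N unfolding min_less_iff_conj by linarith
      then have "L * (1 / 2) ^ n \<le> \<eta> / 2" using L by (simp add: field_simps)
      then have "(\<Lambda> + L * (1 / 2) ^ n) * dist a b \<le> (\<Lambda> + \<eta> / 2) * dist a b"
        by (intro mult_right_mono) auto
      finally show ?thesis .
    qed
    have "dist (interp (\<lambda>n. scale_ext L ((1 / 2) ^ n) g C a) (index t))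
        (interp (\<lambda>n. scale_ext L ((1 / 2) ^ n) g C b) (index t)) \<le> (\<Lambda> + \<eta> / 2) * dist a b"
      by (rule dist_interp_sequences; rule scale) (use tD in linarith)+
    moreover have "6 * L / index t * dist a b \<le> \<eta> / 2 * dist a b"
      using tD \<eta> index_ge_1[of t] by (intro mult_right_mono) (auto simp: field_simps)
    moreover have "(\<Lambda> + \<eta>) * dist a b = (\<Lambda> + \<eta> / 2) * dist a b + \<eta> / 2 * dist a b"
      by (simp add: algebra_simps)
    ultimately show ?thesis
      using glued_ext_two_point[OF ne ab] unfolding t_def by linarith
  qed
  have "(\<Lambda> + \<eta>)-lipschitz_on (ball w \<sigma>) (glued_ext L g C)"
  proof (rule lipschitz_onI)
    show "dist (glued_ext L g C a) (glued_ext L g C b) \<le> (\<Lambda> + \<eta>) * dist a b"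
      if "a \<in> ball w \<sigma>" "b \<in> ball w \<sigma>" for a b
      using *[of a b] *[of b a] that
      by (cases "infdist a C \<le> infdist b C") (auto simp: dist_commute)
  qed (use \<Lambda>0 \<eta> in simp)
  moreover have "0 < \<sigma>" using \<tau> \<rho> by (simp add: \<sigma>_def)
  ultimately show ?thesis by blast
qed

end

section \<open>Asymptotic Lipschitz constants and bounded support\<close>

lemma lip_a_less_lipschitz:
  assumes "lip_a Y h x < ennreal c"
  shows "\<exists>\<rho>>0. c-lipschitz_on (Y \<inter> ball x \<rho>) h"
proof -
  obtain r where r: "0 < r" "Lip h (ball x r \<inter> Y) < ennreal c"
    using assms unfolding lip_a_def INF_less_iff by auto
  have c: "0 < c" using assms by (cases "0 < c") (auto simp: ennreal_neg)
  have "c-lipschitz_on (Y \<inter> ball x r) h"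
  proof (rule lipschitz_onI)
    fix a b assume ab: "a \<in> Y \<inter> ball x r" "b \<in> Y \<inter> ball x r"
    show "dist (h a) (h b) \<le> c * dist a b"
    proof (cases "a = b")
      case False
      then have "ennreal (\<bar>h a - h b\<bar> / dist a b) \<le> Lip h (ball x r \<inter> Y)"
        unfolding Lip_def using ab by (intro Sup_upper) auto
      then have "ennreal (\<bar>h a - h b\<bar> / dist a b) \<le> ennreal c" using r by order
      then show ?thesis using c False by (simp add: dist_real_def field_simps)
    qed simp
  qed (use c in simp)
  then show ?thesis using r by blast
qed

lemma lip_a_le_lipschitz:
  assumes "K-lipschitz_on (Y \<inter> ball x \<rho>) h" "0 < \<rho>"
  shows "lip_a Y h x \<le> ennreal K"
proof -
  have "Lip h (ball x \<rho> \<inter> Y) \<le> ennreal K"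
    unfolding Lip_def
  proof (rule Sup_least)
    fix q assume "q \<in> {ennreal (\<bar>h a - h b\<bar> / dist a b) | a b.
      a \<in> ball x \<rho> \<inter> Y \<and> b \<in> ball x \<rho> \<inter> Y \<and> a \<noteq> b}"
    then obtain a b where q: "q = ennreal (\<bar>h a - h b\<bar> / dist a b)"
      and ab: "a \<in> Y \<inter> ball x \<rho>" "b \<in> Y \<inter> ball x \<rho>" "a \<noteq> b" by auto
    have "dist (h a) (h b) \<le> K * dist a b" using lipschitz_onD[OF assms(1)] ab by auto
    then show "q \<le> ennreal K"
      unfolding q using ab by (intro ennreal_leI) (simp add: dist_real_def field_simps)
  qed
  then show ?thesis
    unfolding lip_a_def using assms(2) by (intro INF_lower2[of \<rho>]) auto
qed

lemma lip_a_mono_domain: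
  assumes "Y \<subseteq> Z"
  shows "lip_a Y h x \<le> lip_a Z h x"
  unfolding lip_a_def Lip_def
  by (intro INF_mono bexI[of _ r for r] Sup_subset_mono) (use assms in auto)

lemma lip_a_le_if_lipschitz_transfer:
  assumes "\<And>\<Lambda> \<rho> \<eta>. 0 < \<rho> \<Longrightarrow> 0 < \<eta> \<Longrightarrow> \<Lambda>-lipschitz_on (Y \<inter> ball x \<rho>) g \<Longrightarrow>
      \<exists>\<sigma>>0. (\<Lambda> + \<eta>)-lipschitz_on (Z \<inter> ball x \<sigma>) h"
  shows "lip_a Z h x \<le> lip_a Y g x"
proof (rule ennreal_le_epsilon)
  fix e :: real assume fin: "lip_a Y g x < top" and e: "0 < e"
  obtain a where a: "lip_a Y g x = ennreal a" "0 \<le> a" using fin by (cases "lip_a Y g x") auto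
  have "lip_a Y g x < ennreal (a + e / 2)" using a e by (simp add: ennreal_less_iff)
  then obtain \<rho> where "0 < \<rho>" "(a + e / 2)-lipschitz_on (Y \<inter> ball x \<rho>) g"
    using lip_a_less_lipschitz by blast
  then obtain \<sigma> where "0 < \<sigma>" "(a + e / 2 + e / 2)-lipschitz_on (Z \<inter> ball x \<sigma>) h"
    using assms[of \<rho> "e / 2" "a + e / 2"] e by fastforce
  then have "lip_a Z h x \<le> ennreal (a + e / 2 + e / 2)" by (intro lip_a_le_lipschitz)
  then have "lip_a Z h x \<le> ennreal (a + e)" by (simp add: add.commute)
  then show "lip_a Z h x \<le> lip_a Y g x + ennreal e" using a e by (simp add: ennreal_plus)
qed

definition cutoff :: "'a::metric_space \<Rightarrow> real \<Rightarrow> 'a \<Rightarrow> real" where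
  "cutoff z R x = max 0 (min 1 (R + 1 - dist z x))"

lemma cutoff_bounds: "0 \<le> cutoff z R x" "cutoff z R x \<le> 1"
  by (auto simp: cutoff_def)

lemma dist_cutoff: "dist (cutoff z R a) (cutoff z R b) \<le> dist a b"
  using dist_triangle[of z a b] dist_triangle[of z b a]
  by (auto simp: cutoff_def dist_real_def dist_commute max_def min_def)

text \<open>
  The product rule in the form in which the cutoff costs nothing where \<open>G\<close> is small.
\<close>

lemma dist_mult_cutoff:
  "dist (G a * cutoff z R a) (G b * cutoff z R b) \<le> dist (G a) (G b) + \<bar>G b\<bar> * dist a b"
proof -
  have "G a * cutoff z R a - G b * cutoff z R b
      = cutoff z R a * (G a - G b) + G b * (cutoff z R a - cutoff z R b)"
    by (simp add: algebra_simps)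
  also have "\<bar>\<dots>\<bar> \<le> cutoff z R a * \<bar>G a - G b\<bar> + \<bar>G b\<bar> * \<bar>cutoff z R a - cutoff z R b\<bar>"
    by (intro order_trans[OF abs_triangle_ineq]) (simp add: abs_mult cutoff_bounds)
  also have "\<dots> \<le> 1 * \<bar>G a - G b\<bar> + \<bar>G b\<bar> * dist a b"
    using dist_cutoff[of z R a b] cutoff_bounds(2)[of z R a]
    by (intro add_mono mult_right_mono mult_left_mono) (auto simp: dist_real_def)
  finally show ?thesis by (simp add: dist_real_def)
qed

lemma lipschitz_mult_cutoff:
  fixes G :: "'a::metric_space \<Rightarrow> real"
  assumes G: "K-lipschitz_on UNIV G" and R: "0 \<le> R"
  shows "(K + (\<bar>G z\<bar> + K * (R + 1)))-lipschitz_on UNIV (\<lambda>x. G x * cutoff z R x)"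
proof (rule lipschitz_onI)
  have K: "0 \<le> K" using lipschitz_on_nonneg[OF G] .
  define N where "N = \<bar>G z\<bar> + K * (R + 1)"
  have N: "0 \<le> N" using K R by (simp add: N_def)
  have *: "dist (G a * cutoff z R a) (G b * cutoff z R b) \<le> (K + N) * dist a b"
    if "cutoff z R b \<noteq> 0" for a b
  proof -
    have "dist z b \<le> R + 1" using that by (auto simp: cutoff_def max_def min_def split: if_splits)
    then have "K * dist z b \<le> K * (R + 1)" using K by (intro mult_left_mono)
    then have "\<bar>G b\<bar> \<le> N"
      using lipschitz_onD[OF G, of z b] by (auto simp: N_def dist_real_def)
    then have "\<bar>G b\<bar> * dist a b \<le> N * dist a b" by (intro mult_right_mono) auto
    then show ?thesis
      using dist_mult_cutoff[of G a z R b] lipschitz_onD[OF G, of a b] by (simp add: algebra_simps)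
  qed
  show "dist (G a * cutoff z R a) (G b * cutoff z R b) \<le> (K + (\<bar>G z\<bar> + K * (R + 1))) * dist a b"
    for a b
  proof (cases "cutoff z R a = 0 \<and> cutoff z R b = 0")
    case True
    then show ?thesis using K N by (simp add: N_def)
  next
    case False
    then show ?thesis using *[of a b] *[of b a] by (auto simp: N_def dist_commute)
  qed
  show "0 \<le> K + (\<bar>G z\<bar> + K * (R + 1))" using K N by (simp add: N_def)
qed

text \<open>
  The cutoff leaves the local constants at points of \<open>C\<close> unchanged: where \<open>g \<noteq> 0\<close> it is
  constantly \<open>1\<close> nearby, and where \<open>g = 0\<close> the glued extension is small nearby, so the
  variation of the cutoff contributes an arbitrarily small slope.
\<close>

lemma Lip_bs_extension:
  fixes C :: "'a::metric_space set"
  assumes C: "closed C" "C \<noteq> {}" and g: "g \<in> Lip_bs C"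
  obtains P where "P \<in> Lip_bs UNIV" "\<And>x. x \<in> C \<Longrightarrow> P x = g x"
    "\<And>x. x \<in> C \<Longrightarrow> lip_a UNIV P x \<le> lip_a C g x"
proof -
  obtain L0 where "L0-lipschitz_on C g" using g by (auto simp: Lip_bs_def)
  then have lip: "(max L0 1)-lipschitz_on C g" by (rule lipschitz_on_le) simp
  have L: "0 < max L0 1" by simp
  have "bounded {x \<in> C. g x \<noteq> 0}"
    using g closure_subset[of "{x \<in> C. g x \<noteq> 0}"]
    by (auto simp: Lip_bs_def intro: bounded_subset)
  then obtain z R0 where R0: "\<And>x. x \<in> C \<Longrightarrow> g x \<noteq> 0 \<Longrightarrow> dist z x \<le> R0"
    unfolding bounded_def by auto
  define R where "R = max 0 R0 + 1"
  have R: "0 \<le> R" "\<And>x. x \<in> C \<Longrightarrow> g x \<noteq> 0 \<Longrightarrow> dist z x < R"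
    using R0 by (fastforce simp: R_def)+
  define G where "G = glued_ext (max L0 1) g C"
  have G: "(12 * max L0 1)-lipschitz_on UNIV G"
    unfolding G_def by (rule lipschitz_glued_ext[OF lip L C(2)])
  have G_eq: "x \<in> C \<Longrightarrow> G x = g x" for x unfolding G_def by (rule glued_ext_eq[OF lip L])
  define P where "P x = G x * cutoff z R x" for x
  show thesis
  proof
    have "{x. P x \<noteq> 0} \<subseteq> cball z (R + 1)"
      by (auto simp: P_def cutoff_def max_def split: if_splits)
    then have "bounded {x. P x \<noteq> 0}" by (rule bounded_subset[OF bounded_cball])
    then show "P \<in> Lip_bs UNIV"
      using lipschitz_mult_cutoff[OF G R(1), of z] by (auto simp: Lip_bs_def P_def bounded_closure)
  next
    fix w assume w: "w \<in> C"
    have one: "cutoff z R x = 1" if "dist z x < R" for x using that by (simp add: cutoff_def)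
    show "P w = g w" using one[of w] R(2)[OF w] G_eq[OF w] by (cases "g w = 0") (auto simp: P_def)
    show "lip_a UNIV P w \<le> lip_a C g w"
    proof (rule lip_a_le_if_lipschitz_transfer)
      fix \<Lambda> \<rho> \<eta> :: real
      assume *: "0 < \<rho>" "0 < \<eta>" "\<Lambda>-lipschitz_on (C \<inter> ball w \<rho>) g"
      then obtain \<sigma> where \<sigma>: "0 < \<sigma>" "(\<Lambda> + \<eta> / 2)-lipschitz_on (ball w \<sigma>) G"
        unfolding G_def using glued_ext_local[OF lip L C(1) w, of \<Lambda> \<rho> "\<eta> / 2"] by auto
      show "\<exists>\<sigma>>0. (\<Lambda> + \<eta>)-lipschitz_on (UNIV \<inter> ball w \<sigma>) P"
      proof (cases "g w = 0")
        case False
        define \<sigma>' where "\<sigma>' = min \<sigma> (R - dist z w)"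
        have "P x = G x" if "x \<in> ball w \<sigma>'" for x
          using one[of x] that dist_triangle[of z x w] by (simp add: P_def \<sigma>'_def)
        then have "(\<Lambda> + \<eta>)-lipschitz_on (ball w \<sigma>') P \<longleftrightarrow> (\<Lambda> + \<eta>)-lipschitz_on (ball w \<sigma>') G"
          by (simp add: lipschitz_on_def)
        also have "(\<Lambda> + \<eta>)-lipschitz_on (ball w \<sigma>') G"
          by (rule lipschitz_on_le[OF lipschitz_on_subset[OF \<sigma>(2)]])
            (use *(2) in \<open>auto simp: \<sigma>'_def\<close>)
        finally show ?thesis using \<sigma>(1) R(2)[OF w False] by (intro exI[of _ \<sigma>']) (simp add: \<sigma>'_def)
      next
        case True
        define K where "K = 12 * max L0 1"
        have K: "0 < K" by (simp add: K_def)
        define \<sigma>' where "\<sigma>' = min \<sigma> (\<eta> / (2 * K))"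
        have "(\<Lambda> + \<eta>)-lipschitz_on (ball w \<sigma>') P"
        proof (rule lipschitz_onI)
          show "0 \<le> \<Lambda> + \<eta>" using * lipschitz_on_nonneg[OF *(3)] by simp
          fix a b assume ab: "a \<in> ball w \<sigma>'" "b \<in> ball w \<sigma>'"
          have "\<bar>G b\<bar> \<le> K * dist w b"
            using lipschitz_onD[OF G, of w b] True G_eq[OF w] by (simp add: K_def dist_real_def)
          also have "\<dots> \<le> K * (\<eta> / (2 * K))"
            using ab K by (intro mult_left_mono) (auto simp: \<sigma>'_def)
          also have "\<dots> = \<eta> / 2" using K by simp
          finally have "\<bar>G b\<bar> * dist a b \<le> \<eta> / 2 * dist a b" by (intro mult_right_mono) auto
          moreover have "dist (G a) (G b) \<le> (\<Lambda> + \<eta> / 2) * dist a b"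
            by (rule lipschitz_onD[OF \<sigma>(2)]) (use ab in \<open>auto simp: \<sigma>'_def\<close>)
          ultimately show "dist (P a) (P b) \<le> (\<Lambda> + \<eta>) * dist a b"
            using dist_mult_cutoff[of G a z R b] by (simp add: P_def algebra_simps)
        qed
        moreover have "0 < \<sigma>'" using \<sigma>(1) * K by (simp add: \<sigma>'_def)
        ultimately show ?thesis by auto
      qed
    qed
  qed
qed

section \<open>Restriction to a set of full measure\<close>

lemma Lip_bs_subset:
  assumes "h \<in> Lip_bs UNIV"
  shows "h \<in> Lip_bs C"
proof -
  have "closure {x \<in> C. h x \<noteq> 0} \<inter> C \<subseteq> closure {x \<in> UNIV. h x \<noteq> 0} \<inter> UNIV"
    using closure_mono[of "{x \<in> C. h x \<noteq> 0}" "{x \<in> UNIV. h x \<noteq> 0}"] by auto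
  then show ?thesis
    using assms by (auto simp: Lip_bs_def intro: lipschitz_on_subset bounded_subset)
qed

lemma borel_measurable_Lip_bs:
  assumes "h \<in> Lip_bs UNIV" "sets M = sets borel"
  shows "h \<in> borel_measurable M"
proof -
  have "continuous_on UNIV h" using assms by (auto simp: Lip_bs_def intro: lipschitz_on_continuous_on)
  then have "h \<in> borel_measurable borel" by (rule borel_measurable_continuous_onI)
  then show ?thesis using measurable_cong_sets[OF assms(2) refl] by blast
qed

lemma ennreal_powr_mono:
  assumes "a \<le> b" "0 \<le> p"
  shows "ennreal_powr a p \<le> ennreal_powr b p"
proof (cases "b = \<infinity>")
  case False
  then have "b < top" by (simp add: less_top)
  then have "a < top" and "enn2real a \<le> enn2real b"
    using assms(1) by (auto intro: enn2real_mono)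
  then show ?thesis
    using False assms(2) by (auto simp: ennreal_powr_def intro!: ennreal_leI powr_mono2)
qed (simp add: ennreal_powr_def)

context
  fixes M :: "'a measure" and C :: "'a set" and p :: real
  assumes C: "C \<in> sets M" and ae: "AE x in M. x \<in> C"
begin

lemma integral_cong_restrict_space:
  assumes u: "u \<in> borel_measurable M" and eq: "\<And>x. x \<in> C \<Longrightarrow> v x = u x"
  shows "(\<integral>x. \<bar>v x\<bar> powr p \<partial>restrict_space M C) = (\<integral>x. \<bar>u x\<bar> powr p \<partial>M)"
    "integrable (restrict_space M C) (\<lambda>x. \<bar>v x\<bar> powr p) \<longleftrightarrow> integrable M (\<lambda>x. \<bar>u x\<bar> powr p)"
proof -
  have sp: "C \<inter> space M \<in> sets M" using C by auto
  have ind: "indicator C x *\<^sub>R \<bar>v x\<bar> powr p = indicator C x *\<^sub>R \<bar>u x\<bar> powr p" for x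
    using eq by (simp add: indicator_def)
  have ae': "AE x in M. indicator C x *\<^sub>R \<bar>u x\<bar> powr p = \<bar>u x\<bar> powr p"
    using ae by eventually_elim simp
  have m: "(\<lambda>x. indicator C x *\<^sub>R \<bar>u x\<bar> powr p) \<in> borel_measurable M"
    "(\<lambda>x. \<bar>u x\<bar> powr p) \<in> borel_measurable M"
    using u C by measurable
  show "(\<integral>x. \<bar>v x\<bar> powr p \<partial>restrict_space M C) = (\<integral>x. \<bar>u x\<bar> powr p \<partial>M)"
    unfolding integral_restrict_space[OF sp] ind by (rule integral_cong_AE[OF m ae'])
  show "integrable (restrict_space M C) (\<lambda>x. \<bar>v x\<bar> powr p) \<longleftrightarrow> integrable M (\<lambda>x. \<bar>u x\<bar> powr p)"
    unfolding integrable_restrict_space[OF sp] ind by (rule integrable_cong_AE[OF m ae'])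
qed

lemma Lp_restrict_space_iff:
  assumes u: "u \<in> borel_measurable M" and eq: "\<And>x. x \<in> C \<Longrightarrow> v x = u x"
  shows "v \<in> Lp p (restrict_space M C) \<longleftrightarrow> u \<in> Lp p M"
proof -
  have "v \<in> borel_measurable (restrict_space M C)"
    using measurable_restrict_space1[OF u, of C] eq
    by (subst measurable_cong[of _ _ u]) (auto simp: space_restrict_space)
  then show ?thesis using u integral_cong_restrict_space(2)[OF u eq] by (simp add: Lp_def)
qed

lemma Lp_tendsto_restrict_space_iff:
  assumes F: "\<And>n. F n \<in> borel_measurable M" and f: "f \<in> borel_measurable M"
    and eq: "\<And>n x. x \<in> C \<Longrightarrow> F' n x = F n x" "\<And>x. x \<in> C \<Longrightarrow> f' x = f x"
  shows "Lp_tendsto p (restrict_space M C) F' f' \<longleftrightarrow> Lp_tendsto p M F f"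
proof -
  have "Lp_norm p (restrict_space M C) (\<lambda>x. F' n x - f' x) = Lp_norm p M (\<lambda>x. F n x - f x)" for n
    unfolding Lp_norm_def
    by (subst integral_cong_restrict_space(1)[of "\<lambda>x. F n x - f x"]) (use F f eq in auto)
  moreover have "F' n \<in> Lp p (restrict_space M C) \<longleftrightarrow> F n \<in> Lp p M" for n
    by (rule Lp_restrict_space_iff[OF F]) (simp add: eq)
  moreover have "f' \<in> Lp p (restrict_space M C) \<longleftrightarrow> f \<in> Lp p M"
    by (rule Lp_restrict_space_iff[OF f]) (simp add: eq)
  ultimately show ?thesis by (simp add: Lp_tendsto_def)
qed

end

theorem theorem3p1:
  fixes M :: "'a::complete_space measure" and C :: "'a set" and p :: real
  assumes "sets M = sets borel"
    and "emeasure M UNIV \<noteq> 0"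
    and "closed C"
    and "emeasure M (UNIV - C) = 0"
    and "1 \<le> p"
  shows "\<forall>f \<in> Lp p M. Ch p M f = Ch p (restrict_space M C) (restrict f C)"
proof
  fix f assume "f \<in> Lp p M"
  then have f: "f \<in> borel_measurable M" by (simp add: Lp_def)
  have sp: "space M = UNIV" using sets_eq_imp_space_eq[OF assms(1)] by simp
  have spC: "space (restrict_space M C) = C" by (simp add: space_restrict_space sp)
  have C: "C \<in> sets M" "C \<inter> space M \<in> sets M" using assms(1,3) by (auto simp: sp)
  have ne: "C \<noteq> {}" using assms(2,4) by auto
  have ae: "AE x in M. x \<in> C"
    using assms(4) sets.compl_sets[OF C(1)] by (intro AE_I[of _ _ "UNIV - C"]) (auto simp: sp)
  note tendsto_iff = Lp_tendsto_restrict_space_iff[OF C(1) ae _ f]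
  show "Ch p M f = Ch p (restrict_space M C) (restrict f C)"
  proof (rule antisym)
    show "Ch p (restrict_space M C) (restrict f C) \<le> Ch p M f"
      unfolding Ch_def[of p M]
    proof (rule Inf_greatest, clarify)
      fix F assume F: "\<forall>n. F n \<in> Lip_bs (space M)" and lim: "Lp_tendsto p M F f"
      have "F n \<in> borel_measurable M" for n
        using F assms(1) by (intro borel_measurable_Lip_bs) (auto simp: sp)
      then have "Lp_tendsto p (restrict_space M C) F (restrict f C)"
        using lim by (subst tendsto_iff) auto
      moreover have "F n \<in> Lip_bs (space (restrict_space M C))" for n
        using F by (simp add: sp spC Lip_bs_subset)
      ultimately have "Ch p (restrict_space M C) (restrict f C)
          \<le> liminf (\<lambda>n. \<integral>\<^sup>+x. ennreal_powr (lip_a C (F n) x) p \<partial>restrict_space M C)"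
        unfolding Ch_def spC by (intro Inf_lower) (auto simp: spC)
      also have "\<dots> \<le> liminf (\<lambda>n. \<integral>\<^sup>+x. ennreal_powr (lip_a UNIV (F n) x) p \<partial>M)"
      proof (intro Liminf_mono always_eventually allI)
        fix n
        show "(\<integral>\<^sup>+x. ennreal_powr (lip_a C (F n) x) p \<partial>restrict_space M C)
            \<le> (\<integral>\<^sup>+x. ennreal_powr (lip_a UNIV (F n) x) p \<partial>M)"
          unfolding nn_integral_restrict_space[OF C(2)] using assms(5)
          by (intro nn_integral_mono)
            (auto simp: indicator_def intro!: ennreal_powr_mono lip_a_mono_domain)
      qed
      finally show "Ch p (restrict_space M C) (restrict f C)
          \<le> liminf (\<lambda>n. \<integral>\<^sup>+x. ennreal_powr (lip_a (space M) (F n) x) p \<partial>M)"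
        by (simp add: sp)
    qed
  next
    show "Ch p M f \<le> Ch p (restrict_space M C) (restrict f C)"
      unfolding Ch_def[of p "restrict_space M C"] spC
    proof (rule Inf_greatest, clarify)
      fix F assume F: "\<forall>n. F n \<in> Lip_bs C"
        and lim: "Lp_tendsto p (restrict_space M C) F (restrict f C)"
      have "\<exists>P. P \<in> Lip_bs UNIV \<and> (\<forall>x\<in>C. P x = F n x \<and> lip_a UNIV P x \<le> lip_a C (F n) x)" for n
        using F Lip_bs_extension[OF assms(3) ne, of "F n"] by metis
      then obtain P where P: "\<And>n. P n \<in> Lip_bs UNIV" "\<And>n x. x \<in> C \<Longrightarrow> P n x = F n x"
        "\<And>n x. x \<in> C \<Longrightarrow> lip_a UNIV (P n) x \<le> lip_a C (F n) x"
        by metis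
      have "P n \<in> borel_measurable M" for n
        using P(1) assms(1) by (rule borel_measurable_Lip_bs)
      then have "Lp_tendsto p M P f"
        using lim P(2) by (subst tendsto_iff[of P F "restrict f C", symmetric]) auto
      then have "Ch p M f \<le> liminf (\<lambda>n. \<integral>\<^sup>+x. ennreal_powr (lip_a UNIV (P n) x) p \<partial>M)"
        unfolding Ch_def sp using P(1) by (intro Inf_lower) auto
      also have "\<dots> \<le> liminf (\<lambda>n. \<integral>\<^sup>+x. ennreal_powr (lip_a C (F n) x) p \<partial>restrict_space M C)"
      proof (intro Liminf_mono always_eventually allI)
        fix n
        show "(\<integral>\<^sup>+x. ennreal_powr (lip_a UNIV (P n) x) p \<partial>M)
            \<le> (\<integral>\<^sup>+x. ennreal_powr (lip_a C (F n) x) p \<partial>restrict_space M C)"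
          unfolding nn_integral_restrict_space[OF C(2)]
        proof (rule nn_integral_mono_AE)
          show "AE x in M. ennreal_powr (lip_a UNIV (P n) x) p
              \<le> ennreal_powr (lip_a C (F n) x) p * indicator C x"
            using ae by eventually_elim (use P(3) assms(5) in \<open>auto intro!: ennreal_powr_mono\<close>)
        qed
      qed
      finally show "Ch p M f
          \<le> liminf (\<lambda>n. \<integral>\<^sup>+x. ennreal_powr (lip_a C (F n) x) p \<partial>restrict_space M C)" .
    qed
  qed
qed

end
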